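(* Let $\mathcal M=(\pi_0,K,g)$ be the linear-Gaussian state-space model on $\mathcal X=\mathbb R^{d_x}$ with $\pi_0=\mathcal N(m_0,P_0)$, $K_t(x_{t-1},\cdot)=\mathcal N(A_tx_{t-1},Q_t)$ and $$g_t(x)\propto\exp\{-\tfrac12(y_t-C_tx)^{\mathsf T}R_t^{-1}(y_t-C_tx)\},\qquad t=1,\dots,T,$$ where $y_t\in\mathbb R^{d_y}$ are fixed observations, $A_t,C_t$ are known matrices, and $Q_t,R_t$ are symmetric positive definite. Let $$\alpha_t(x,\gamma)=x+\gamma\nabla\log g_t(x)=(I-\gamma C_t^{\mathsf T}R_t^{-1}C_t)x+\gamma C_t^{\mathsf T}R_t^{-1}y_t .$$ Then there is a sequence of positive parameters $\gamma_{1:T}$ such that the nudged model $\mathcal M^\alpha=(\pi_0,K^\alpha,g)$ with $$K_t^\alpha(x_{t-1},\cdot)=\mathcal N\big(M_tA_tx_{t-1}+\gamma_tC_t^{\mathsf T}R_t^{-1}y_t,\ M_tQ_tM_t^{\mathsf T}\big),\qquad M_t=I-\gamma_tC_t^{\mathsf T}R_t^{-1}C_t$$ (the image of $K_t(x_{t-1},\cdot)$ under $\alpha_t(\cdot,\gamma_t)$), satisfies $p_T(y_{1:T}\mid\mathcal M^\alpha)\ge p_T(y_{1:T}\mid\mathcal M)$.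
   Context: $\mathcal N(m,P)$ denotes the Gaussian law with mean $m$ and covariance $P$. For a state-space model $(\pi_0,K,g)$ with prior $\pi_0$, Markov kernels $K_t$ and likelihood functions $g_t>0$, the predictive measures and filters are defined recursively for $t\ge1$ by $\xi_t(dx)=\int K_t(x',dx)\,\pi_{t-1}(dx')$ and $\pi_t(f)=\xi_t(fg_t)/\xi_t(g_t)$, where $\mu(f)=\int f\,d\mu$. The Bayesian evidence (marginal likelihood) is $p_T(y_{1:T}\mid\cdot)=\prod_{t=1}^T\xi_t(g_t)$, computed with the respective kernels ($K_t$ for $\mathcal M$, $K^\alpha_t$ for $\mathcal M^\alpha$) and the same $\pi_0$ and $g$. The constants of proportionality in $g_t$ do not depend on $x$ and are the same for both models. *)

theory Defs
  imports "HOL-Probability.Probability"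
begin

definition sym_pos_def :: "real^'n^'n \<Rightarrow> bool" where
  "sym_pos_def P \<longleftrightarrow> transpose P = P \<and> (\<forall>x. x \<noteq> 0 \<longrightarrow> 0 < x \<bullet> (P *v x))"

definition sym_pos_semidef :: "real^'n^'n \<Rightarrow> bool" where
  "sym_pos_semidef P \<longleftrightarrow> transpose P = P \<and> (\<forall>x. 0 \<le> x \<bullet> (P *v x))"

definition std_gaussian :: "(real^'n) measure" where
  "std_gaussian = density lborel (\<lambda>z. ennreal (\<Prod>i\<in>UNIV. std_normal_density (z $ i)))"

text \<open>The law \<open>N(m, P)\<close> is the law of \<open>m + S Z\<close> with \<open>Z\<close> standard Gaussian and \<open>S S\<^sup>T = P\<close>.
  Such an \<open>S\<close> exists for every symmetric positive semidefinite \<open>P\<close>, and the law depends on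
  \<open>S\<close> only through \<open>S S\<^sup>T\<close>. Unlike a definition by a Lebesgue density, this covers singular
  covariances, which arise for the nudged kernel when \<open>M\<^sub>t\<close> is singular.\<close>

definition gaussian :: "real^'n \<Rightarrow> real^'n^'n \<Rightarrow> (real^'n) measure" where
  "gaussian m P = distr std_gaussian borel
     (\<lambda>z. m + (SOME S :: real^'n^'n. S ** transpose S = P) *v z)"

text \<open>A state-space model is given by a prior \<open>\<pi>\<^sub>0\<close>, kernels \<open>K t\<close> and likelihoods \<open>g t\<close>; only the
  indices \<open>t \<ge> 1\<close> of \<open>K\<close> and \<open>g\<close> matter.\<close>

primrec filter_law ::
  "'a measure \<Rightarrow> (nat \<Rightarrow> 'a \<Rightarrow> 'a measure) \<Rightarrow> (nat \<Rightarrow> 'a \<Rightarrow> real) \<Rightarrow> nat \<Rightarrow> 'a measure" where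
  "filter_law \<pi>0 K g 0 = \<pi>0"
| "filter_law \<pi>0 K g (Suc t) =
     (let \<xi> = bind (filter_law \<pi>0 K g t) (K (Suc t))
      in density \<xi> (\<lambda>x. ennreal (g (Suc t) x / (\<integral>x'. g (Suc t) x' \<partial>\<xi>))))"

definition predictive ::
  "'a measure \<Rightarrow> (nat \<Rightarrow> 'a \<Rightarrow> 'a measure) \<Rightarrow> (nat \<Rightarrow> 'a \<Rightarrow> real) \<Rightarrow> nat \<Rightarrow> 'a measure" where
  "predictive \<pi>0 K g t = bind (filter_law \<pi>0 K g (t - 1)) (K t)"

definition evidence ::
  "'a measure \<Rightarrow> (nat \<Rightarrow> 'a \<Rightarrow> 'a measure) \<Rightarrow> (nat \<Rightarrow> 'a \<Rightarrow> real) \<Rightarrow> nat \<Rightarrow> real" where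
  "evidence \<pi>0 K g T = (\<Prod>t = 1..T. \<integral>x. g t x \<partial>predictive \<pi>0 K g t)"

definition gradient :: "('a::real_inner \<Rightarrow> real) \<Rightarrow> 'a \<Rightarrow> 'a" where
  "gradient f x = (THE D. GDERIV f x :> D)"

definition nudge :: "(nat \<Rightarrow> 'a::real_inner \<Rightarrow> real) \<Rightarrow> nat \<Rightarrow> 'a \<Rightarrow> real \<Rightarrow> 'a" where
  "nudge g t x \<gamma> = x + \<gamma> *\<^sub>R gradient (\<lambda>x'. ln (g t x')) x"

definition lin_gauss_kernel ::
  "(nat \<Rightarrow> real^'n^'n) \<Rightarrow> (nat \<Rightarrow> real^'n^'n) \<Rightarrow> nat \<Rightarrow> real^'n \<Rightarrow> (real^'n) measure" where
  "lin_gauss_kernel A Q t x = gaussian (A t *v x) (Q t)"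

definition nudge_matrix :: "real^'n^'m \<Rightarrow> real^'m^'m \<Rightarrow> real \<Rightarrow> real^'n^'n" where
  "nudge_matrix C R \<gamma> = mat 1 - \<gamma> *\<^sub>R (transpose C ** matrix_inv R ** C)"

definition nudge_shift :: "real^'n^'m \<Rightarrow> real^'m^'m \<Rightarrow> real^'m \<Rightarrow> real \<Rightarrow> real^'n" where
  "nudge_shift C R y \<gamma> = \<gamma> *\<^sub>R ((transpose C ** matrix_inv R) *v y)"

definition nudged_kernel ::
  "(nat \<Rightarrow> real^'n^'n) \<Rightarrow> (nat \<Rightarrow> real^'n^'n) \<Rightarrow> (nat \<Rightarrow> real^'n^'m) \<Rightarrow> (nat \<Rightarrow> real^'m^'m) \<Rightarrow>
   (nat \<Rightarrow> real^'m) \<Rightarrow> (nat \<Rightarrow> real) \<Rightarrow> nat \<Rightarrow> real^'n \<Rightarrow> (real^'n) measure" where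
  "nudged_kernel A Q C R y \<gamma> t x =
     (let M = nudge_matrix (C t) (R t) (\<gamma> t)
      in gaussian (M *v (A t *v x) + nudge_shift (C t) (R t) (y t) (\<gamma> t)) (M ** Q t ** transpose M))"

end

theory Submission
  imports Defs
begin

text \<open>Let \<open>s\<close> be the last time with \<open>C\<^sub>s \<noteq> 0\<close> (if there is none, nudging does nothing). Nudging at
  time \<open>s\<close> alone, with a small step along the gradient, increases \<open>g\<^sub>s\<close> off a proper affine subspace,
  which is a null set for the predictive law because \<open>Q\<^sub>s\<close> is positive definite. Later likelihoods are
  constant, so the evidence strictly increases. The evidence depends continuously on the remaining
  parameters (dominated convergence in an iterated integral), so these can be moved from \<open>0\<close> to a
  small positive value without losing the gain. Nudging at an earlier time may by itself decrease
  the evidence, since it moves the state away from what later observations demand.\<close>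

section \<open>Positive definite matrices and their square roots\<close>

lemma matrix_inner_adjoint: "x \<bullet> ((A::real^'n^'m) *v y) = (transpose A *v x) \<bullet> y"
  by (simp add: dot_lmul_matrix)

lemma matrix_vector_mult_component_row: "(A *v x) $ i = row i A \<bullet> x" for A :: "real^'n^'m"
  by (simp add: matrix_vector_mul_component row_def)

lemma matrix_mult_component_rows:
  "(A ** transpose B) $ i $ j = row i A \<bullet> row j B" for A :: "real^'n^'m" and B :: "real^'n^'k"
  by (simp add: matrix_matrix_mult_def transpose_def row_def inner_vec_def)

text \<open>For \<open>w \<noteq> 0\<close> this is the reflection in the hyperplane orthogonal to
  \<open>w\<close>. For \<open>w = 0\<close> the subtracted term vanishes and it is the identity, as
  wanted when the two vectors to be matched already agree.\<close>

definition householder :: "'a::real_inner \<Rightarrow> 'a \<Rightarrow> 'a" where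
  "householder w x = x - (2 * (w \<bullet> x) / (w \<bullet> w)) *\<^sub>R w"

lemma orthogonal_transformation_householder: "orthogonal_transformation (householder w)"
  unfolding orthogonal_transformation_def
proof (intro conjI allI)
  show "linear (householder w)"
    by (rule linearI) (simp_all add: householder_def algebra_simps add_divide_distrib)
  show "householder w u \<bullet> householder w v = u \<bullet> v" for u v
    by (cases "w = 0") (simp_all add: householder_def inner_diff_left inner_diff_right inner_commute field_simps)
qed

lemma householder_orthogonal: "w \<bullet> x = 0 \<Longrightarrow> householder w x = x"
  by (simp add: householder_def)

text \<open>Equal norms make \<open>x - y\<close> normal to a hyperplane that bisects the two
  vectors; the coefficient of \<open>x - y\<close> in the reflection of \<open>x\<close> is then
  1.\<close>

lemma householder_swap:
  assumes "norm x = norm y" shows "householder (x - y) x = y"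
proof (cases "x = y")
  case False
  have "x \<bullet> x = y \<bullet> y" using assms by (simp add: norm_eq)
  hence "(x - y) \<bullet> (x - y) = 2 * ((x - y) \<bullet> x)" by (simp add: inner_diff inner_commute)
  moreover have "(x - y) \<bullet> (x - y) \<noteq> 0" using False by simp
  ultimately show ?thesis by (simp add: householder_def)
qed (simp add: householder_def)

text \<open>A Householder reflection that corrects the image of one more vector fixes the vectors already
  matched, since their inner products with it agree.\<close>

lemma gram_eq_imp_orthogonal_transformation:
  fixes u v :: "'i \<Rightarrow> 'a::real_inner"
  assumes "finite I" "\<And>i j. i \<in> I \<Longrightarrow> j \<in> I \<Longrightarrow> u i \<bullet> u j = v i \<bullet> v j"
  shows "\<exists>f. orthogonal_transformation f \<and> (\<forall>i\<in>I. f (u i) = v i)"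
  using assms
proof (induction I rule: finite_induct)
  case empty
  show ?case by (auto intro: exI[of _ "\<lambda>x. x"])
next
  case (insert k I)
  then obtain f where f: "orthogonal_transformation f" "\<And>i. i \<in> I \<Longrightarrow> f (u i) = v i"
    by (metis insertCI)
  let ?h = "householder (f (u k) - v k)"
  have nrm: "norm (f (u k)) = norm (v k)"
    using f(1) insert.prems[of k k] by (simp add: orthogonal_transformation_def norm_eq_sqrt_inner)
  have "(f (u k) - v k) \<bullet> v i = 0" if "i \<in> I" for i
    using f that insert.prems[of k i]
    by (metis (no_types, lifting) inner_diff_left insertI1 insertI2 orthogonal_transformation_def right_minus_eq)
  hence "(?h \<circ> f) (u i) = v i" if "i \<in> insert k I" for i
    using that f(2) nrm by (auto simp: householder_orthogonal householder_swap)
  moreover have "orthogonal_transformation (?h \<circ> f)"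
    by (rule orthogonal_transformation_compose) (simp_all add: orthogonal_transformation_householder f)
  ultimately show ?case by blast
qed

text \<open>The entries of \<open>S ** transpose S\<close> are the inner products of the rows of
  \<open>S\<close>. Equal products thus mean equal Gram matrices, and an orthogonal \<open>f\<close>
  carries the rows of \<open>U\<close> to those of \<open>S\<close>. So two square roots of one
  covariance differ only by an orthogonal map of the noise.\<close>

lemma mult_transpose_eq_imp_orthogonal:
  fixes S U :: "real^'n^'m"
  assumes "S ** transpose S = U ** transpose U"
  obtains f where "orthogonal_transformation f" "\<And>z. S *v f z = U *v z"
proof -
  have "row i U \<bullet> row j U = row i S \<bullet> row j S" for i j
    using assms by (metis matrix_mult_component_rows)
  then obtain f where f: "orthogonal_transformation f" "\<And>i. f (row i U) = row i S"
    using gram_eq_imp_orthogonal_transformation[of UNIV "\<lambda>i. row i U" "\<lambda>i. row i S"] by auto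
  show thesis
  proof (rule that[OF f(1)])
    fix z show "S *v f z = U *v z"
      using f by (simp add: vec_eq_iff matrix_vector_mult_component_row orthogonal_transformation_def flip: f(2))
  qed
qed

section \<open>Square root and inverse of a positive definite matrix\<close>

lemma sym_pos_def_symmetric: "sym_pos_def P \<Longrightarrow> x \<bullet> (P *v y) = y \<bullet> (P *v x)"
  by (metis inner_commute matrix_inner_adjoint sym_pos_def_def)

text \<open>Gram--Schmidt for the inner product with matrix \<open>P\<close>.\<close>

lemma sym_pos_def_orthonormal_family:
  fixes P :: "real^'n^'n" and F :: "'n set"
  assumes P: "sym_pos_def P"
  shows "\<exists>v :: 'n \<Rightarrow> real^'n. \<forall>i\<in>F. \<forall>j\<in>F. v i \<bullet> (P *v v j) = (if i = j then 1 else 0)"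
  using finite[of F]
proof (induction F rule: finite_induct)
  case (insert k F)
  then obtain v :: "'n \<Rightarrow> real^'n"
    where v: "\<And>i j. i \<in> F \<Longrightarrow> j \<in> F \<Longrightarrow> v i \<bullet> (P *v v j) = (if i = j then 1 else 0)"
    by blast
  \<comment> \<open>As \<open>k\<close> lies outside \<open>F\<close>, the vectors
    \<open>P *v v i\<close> with \<open>i \<in> F\<close> cannot span the whole space. This leaves a
    nonzero \<open>w\<close> orthogonal to all of them, hence orthogonal for \<open>P\<close> to
    every \<open>v i\<close>; scaled by \<open>1 / q\<close> it becomes the new member of the
    family.\<close>
  have "dim ((\<lambda>i. P *v v i) ` F) \<le> card F"
    by (meson card_image_le dim_le_card' finite finite_imageI order_trans)
  also have "card F < CARD('n)"
    using insert.hyps by (metis UNIV_I finite psubset_card_mono psubsetI subset_UNIV)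
  finally obtain w where w: "w \<noteq> 0" "\<And>x. x \<in> span ((\<lambda>i. P *v v i) ` F) \<Longrightarrow> orthogonal w x"
    using orthogonal_to_subspace_exists[of "(\<lambda>i. P *v v i) ` F"] by auto
  have wF: "w \<bullet> (P *v v i) = 0" "v i \<bullet> (P *v w) = 0" if "i \<in> F" for i
    using w(2)[of "P *v v i"] that sym_pos_def_symmetric[OF P, of w "v i"]
    by (auto simp: orthogonal_def span_base)
  define q where "q = sqrt (w \<bullet> (P *v w))"
  have "w \<bullet> (P *v w) > 0" using P w(1) by (simp add: sym_pos_def_def)
  hence q: "q \<noteq> 0" "w \<bullet> (P *v w) = q * q" by (simp_all add: q_def)
  let ?v = "v(k := (1 / q) *\<^sub>R w)"
  have "?v i \<bullet> (P *v ?v j) = (if i = j then 1 else 0)" if "i \<in> insert k F" "j \<in> insert k F" for i j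
    using that insert.hyps(2) v wF q by (auto simp: matrix_vector_mult_scaleR)
  thus ?case by blast
qed simp

text \<open>If the columns of \<open>B\<close> are orthonormal for \<open>P\<close>, then
  \<open>transpose B ** P\<close> is a left and hence a right inverse of \<open>B\<close>. So
  \<open>P ** B\<close> is a root: its product with its transpose is
  \<open>P ** B ** transpose B ** P = P\<close>.\<close>

lemma sym_pos_def_root:
  fixes P :: "real^'n^'n"
  assumes P: "sym_pos_def P"
  obtains S :: "real^'n^'n" where "S ** transpose S = P"
proof -
  obtain v :: "'n \<Rightarrow> real^'n" where v: "\<And>i j. v i \<bullet> (P *v v j) = (if i = j then 1 else 0)"
    using sym_pos_def_orthonormal_family[OF P, of UNIV] by auto
  define B :: "real^'n^'n" where "B = transpose (\<chi> i. v i)"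
  have "(transpose B ** P) ** B = mat 1"
  proof -
    have "((transpose B ** P) ** B) $ i $ j = v i \<bullet> (P *v v j)" for i j
    proof -
      have "transpose B ** (P ** B) = transpose B ** transpose (transpose (P ** B))"
        by simp
      moreover have "row j (transpose (P ** B)) = P *v v j"
        by (simp add: vec_eq_iff row_def transpose_def B_def matrix_matrix_mult_def matrix_vector_mult_def)
      moreover have "row i (transpose B) = v i" by (simp add: B_def row_def vec_eq_iff)
      ultimately show ?thesis
        by (metis matrix_mul_assoc matrix_mult_component_rows)
    qed
    thus ?thesis by (simp add: vec_eq_iff v mat_def)
  qed
  hence 1: "B ** (transpose B ** P) = mat 1" by (rule matrix_left_right_inverse1)
  have "(P ** B) ** transpose (P ** B) = P ** (B ** (transpose B ** P))"
    using P by (simp add: matrix_transpose_mul matrix_mul_assoc sym_pos_def_def)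
  with 1 that show thesis by simp
qed

lemma sym_pos_def_invertible:
  assumes "sym_pos_def (P :: real^'n^'n)" shows "invertible P"
proof -
  have "x = 0" if "P *v x = 0" for x
    using assms that by (metis inner_zero_right less_irrefl sym_pos_def_def)
  hence "\<exists>B. B ** P = mat 1" by (subst matrix_left_invertible_ker) blast
  thus ?thesis by (simp add: invertible_left_inverse)
qed

text \<open>Symmetry follows from uniqueness of the inverse. With
  \<open>u = matrix_inv P *v x\<close>, the form of the inverse at \<open>x\<close> is the form of
  \<open>P\<close> at \<open>u\<close>.\<close>

lemma sym_pos_def_matrix_inv:
  assumes P: "sym_pos_def (P :: real^'n^'n)" shows "sym_pos_def (matrix_inv P)"
proof -
  let ?W = "matrix_inv P"
  have inv: "P ** ?W = mat 1" "?W ** P = mat 1"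
    using sym_pos_def_invertible[OF P] unfolding invertible_def matrix_inv_def
    by (rule someI2_ex; blast)+
  have "transpose ?W ** P = mat 1"
    using P inv by (metis matrix_transpose_mul sym_pos_def_def transpose_mat)
  hence "transpose ?W = ?W"
    by (metis inv(1) matrix_mul_assoc matrix_mul_lid matrix_mul_rid)
  moreover have "0 < x \<bullet> (?W *v x)" if "x \<noteq> 0" for x
  proof -
    have x: "x = P *v (?W *v x)" by (simp add: matrix_vector_mul_assoc inv)
    hence "?W *v x \<noteq> 0" using that by (metis matrix_vector_mult_0_right)
    hence "0 < (?W *v x) \<bullet> (P *v (?W *v x))" using P by (auto simp only: sym_pos_def_def)
    thus ?thesis by (simp flip: x add: inner_commute)
  qed
  ultimately show ?thesis by (simp add: sym_pos_def_def)
qed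

section \<open>Affine images of Gaussian laws\<close>

lemma orthogonal_transformation_measurable:
  fixes f :: "'a::euclidean_space \<Rightarrow> 'a"
  assumes "orthogonal_transformation f" shows "f \<in> borel_measurable borel"
  using assms by (intro borel_measurable_continuous_onI linear_continuous_on)
    (simp add: orthogonal_transformation_linear linear_linear)

text \<open>Averaging \<open>k \<circ> f\<close> against the translates of a rotation-invariant indicator \<open>B\<close> and exchanging
  the order of integration moves \<open>f\<close> from \<open>k\<close> to \<open>B\<close>, where it disappears.\<close>

lemma nn_integral_lborel_orthogonal:
  fixes f :: "'a::euclidean_space \<Rightarrow> 'a"
  assumes f: "orthogonal_transformation f" and k[measurable]: "k \<in> borel_measurable borel"
  shows "(\<integral>\<^sup>+x. k (f x) \<partial>lborel) = (\<integral>\<^sup>+x. k x \<partial>lborel)"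
proof -
  note [measurable] = orthogonal_transformation_measurable[OF f]
  obtain f' where f': "\<And>x. f (f' x) = x"
    using orthogonal_transformation_surj[OF f] by (metis surjD)
  \<comment> \<open>The unit ball is invariant under \<open>f\<close>, and its measure
    \<open>b\<close> is finite and nonzero, so that \<open>b\<close> can be cancelled at the
    end.\<close>
  define B :: "'a \<Rightarrow> ennreal" where "B = indicator (ball 0 1)"
  have [measurable]: "B \<in> borel_measurable borel"
    unfolding B_def by (rule borel_measurable_indicator) simp
  have B_rot: "B (y - f x) = B (f' y - x)" for x y
  proof -
    have "norm (y - f x) = norm (f (f' y - x))"
      by (simp add: f' linear_diff[OF orthogonal_transformation_linear[OF f]])
    thus ?thesis using f by (simp add: B_def indicator_def orthogonal_transformation_norm)
  qed
  have shift: "(\<integral>\<^sup>+x. h x \<partial>lborel) = (\<integral>\<^sup>+x. h (c + x) \<partial>lborel)"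
    if [measurable]: "h \<in> borel_measurable borel" for h :: "'a \<Rightarrow> ennreal" and c
    by (subst lborel_distr_plus[of c, symmetric]) (simp add: nn_integral_distr)
  have reflect: "(\<integral>\<^sup>+x. h x \<partial>lborel) = (\<integral>\<^sup>+x. h (c - x) \<partial>lborel)"
    if [measurable]: "h \<in> borel_measurable borel" for h :: "'a \<Rightarrow> ennreal" and c
    by (subst lborel_affine[of "-1" c]) (simp_all add: nn_integral_density nn_integral_distr)
  define b where "b = emeasure lborel (ball (0::'a) 1)"
  have b: "(\<integral>\<^sup>+x. B x \<partial>lborel) = b" by (simp add: B_def b_def)
  have "b * (\<integral>\<^sup>+x. k (f x) \<partial>lborel) = (\<integral>\<^sup>+x. \<integral>\<^sup>+y. B y * k (f x) \<partial>lborel \<partial>lborel)"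
    by (simp add: nn_integral_multc nn_integral_cmult b)
  also have "\<dots> = (\<integral>\<^sup>+x. \<integral>\<^sup>+y. B (y - f x) * k (f x) \<partial>lborel \<partial>lborel)"
    using shift[of "\<lambda>y. B y * k (f x)" "- f x" for x] by (simp add: algebra_simps)
  also have "\<dots> = (\<integral>\<^sup>+y. \<integral>\<^sup>+x. B (f' y - x) * k (f x) \<partial>lborel \<partial>lborel)"
    unfolding B_rot[symmetric] by (rule lborel_pair.Fubini') measurable
  \<comment> \<open>Substituting \<open>f' y - x\<close> for \<open>x\<close> turns
    \<open>k (f x)\<close> into \<open>k (y - f x)\<close>, where \<open>f x\<close> is a mere
    translation for the integral over \<open>y\<close>.\<close>
  also have "\<dots> = (\<integral>\<^sup>+y. \<integral>\<^sup>+x. B x * k (y - f x) \<partial>lborel \<partial>lborel)"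
    using reflect[of "\<lambda>x. B (f' y - x) * k (f x)" "f' y" for y]
    by (simp add: f' linear_diff[OF orthogonal_transformation_linear[OF f]])
  also have "\<dots> = (\<integral>\<^sup>+x. \<integral>\<^sup>+y. B x * k (y - f x) \<partial>lborel \<partial>lborel)"
    by (rule lborel_pair.Fubini') measurable
  also have "\<dots> = (\<integral>\<^sup>+x. B x * (\<integral>\<^sup>+y. k y \<partial>lborel) \<partial>lborel)"
    using shift[of k "- f x" for x] by (simp add: nn_integral_cmult)
  also have "\<dots> = b * (\<integral>\<^sup>+y. k y \<partial>lborel)"
    by (simp add: nn_integral_multc b)
  finally have "b * (\<integral>\<^sup>+x. k (f x) \<partial>lborel) = b * (\<integral>\<^sup>+y. k y \<partial>lborel)" .
  moreover have "b < \<infinity>" unfolding b_def by (rule emeasure_lborel_ball_finite)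
  moreover have "b \<noteq> 0"
    using content_ball_pos[of 1 "0::'a"] by (auto simp: b_def measure_def)
  ultimately show ?thesis by (auto simp: ennreal_mult_cancel_left)
qed

text \<open>The density depends on the norm alone; this is the source of the rotation invariance of
  the law.\<close>

lemma std_gaussian_density_norm:
  "(\<Prod>i\<in>UNIV. std_normal_density ((z::real^'n) $ i)) =
    (1 / sqrt (2 * pi)) ^ CARD('n) * exp (- (norm z)\<^sup>2 / 2)"
proof -
  have "- (norm z)\<^sup>2 / 2 = (\<Sum>i\<in>UNIV. - (z $ i)\<^sup>2 / 2)"
    by (simp add: norm_vec_def L2_set_def sum_nonneg sum_divide_distrib sum_negf)
  thus ?thesis
    by (simp add: std_normal_density_def exp_sum prod_dividef power_divide)
qed

lemma sets_std_gaussian[simp, measurable_cong]: "sets std_gaussian = sets borel"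
  by (simp add: std_gaussian_def)

lemma space_std_gaussian[simp]: "space std_gaussian = UNIV"
  by (simp add: std_gaussian_def)

lemma prob_space_std_gaussian: "prob_space (std_gaussian :: (real^'n) measure)"
proof
  have Basis_eq: "(Basis :: (real^'n) set) = range (\<lambda>i. axis i 1)"
    by (auto simp: Basis_vec_def)
  have "emeasure (std_gaussian :: (real^'n) measure) (space std_gaussian) =
      (\<integral>\<^sup>+(z::real^'n). (\<Prod>b\<in>Basis. ennreal (std_normal_density (z \<bullet> b))) \<partial>lborel)"
    by (simp add: std_gaussian_def emeasure_density Basis_eq prod.reindex inj_on_def axis_eq_axis
        inner_axis prod_ennreal)
  also have "\<dots> = (\<Prod>b\<in>(Basis :: (real^'n) set). \<integral>\<^sup>+x. ennreal (std_normal_density x) \<partial>lborel)"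
    by (rule nn_integral_lborel_prod) auto
  also have "(\<integral>\<^sup>+x. ennreal (std_normal_density x) \<partial>lborel) = 1"
    using prob_space.emeasure_space_1[OF prob_space_normal_density[of 1 0]]
    by (simp add: emeasure_density)
  finally show "emeasure (std_gaussian :: (real^'n) measure) (space std_gaussian) = 1"
    by simp
qed

lemma borel_measurable_matrix_vector_mult[measurable]:
  "(*v) (A :: real^'n^'m) \<in> borel_measurable borel"
  by (intro borel_measurable_continuous_onI linear_continuous_on) (simp add: linear_linear)

lemma distr_std_gaussian_orthogonal:
  fixes f :: "real^'n \<Rightarrow> real^'n"
  assumes f: "orthogonal_transformation f"
  shows "distr std_gaussian borel f = std_gaussian"
proof (rule measure_eqI)
  note [measurable] = orthogonal_transformation_measurable[OF f]
  fix X assume "X \<in> sets (distr std_gaussian borel f)"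
  hence X[measurable]: "X \<in> sets borel" by simp
  let ?d = "\<lambda>z::real^'n. ennreal (\<Prod>i\<in>UNIV. std_normal_density (z $ i))"
  have "emeasure (distr std_gaussian borel f) X = (\<integral>\<^sup>+z. indicator X (f z) \<partial>std_gaussian)"
    by (simp flip: nn_integral_indicator add: nn_integral_distr)
  also have "\<dots> = (\<integral>\<^sup>+z. ?d (f z) * indicator X (f z) \<partial>lborel)"
    using f by (simp add: std_gaussian_def nn_integral_density std_gaussian_density_norm
        orthogonal_transformation_norm)
  also have "\<dots> = (\<integral>\<^sup>+z. ?d z * indicator X z \<partial>lborel)"
    by (rule nn_integral_lborel_orthogonal[OF f]) measurable
  also have "\<dots> = emeasure std_gaussian X"
    by (simp add: std_gaussian_def emeasure_density)
  finally show "emeasure (distr std_gaussian borel f) X = emeasure std_gaussian X" .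
qed simp

text \<open>Removes the arbitrary choice in \<open>gaussian\<close>: the chosen root and
  \<open>S\<close> differ by an orthogonal map, which leaves the standard Gaussian law
  unchanged.\<close>

lemma gaussian_eq_distr:
  fixes S :: "real^'n^'n"
  assumes S: "S ** transpose S = P"
  shows "gaussian m P = distr std_gaussian borel (\<lambda>z. m + S *v z)"
proof -
  define U :: "real^'n^'n" where "U = (SOME S. S ** transpose S = P)"
  have "U ** transpose U = P" unfolding U_def using S by (rule someI)
  with S obtain f where f: "orthogonal_transformation f" "\<And>z. U *v f z = S *v z"
    using mult_transpose_eq_imp_orthogonal[of U S] by metis
  note [measurable] = orthogonal_transformation_measurable[OF f(1)]
  have "gaussian m P = distr (distr std_gaussian borel f) borel (\<lambda>z. m + U *v z)"
    by (simp add: gaussian_def U_def distr_std_gaussian_orthogonal[OF f(1)])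
  also have "\<dots> = distr std_gaussian borel (\<lambda>z. m + S *v z)"
    by (simp add: distr_distr comp_def f(2))
  finally show ?thesis .
qed

text \<open>If \<open>S\<close> is a root of \<open>P\<close>, then \<open>M ** S\<close> is a root
  of the new covariance. The argument works with roots rather than densities and so covers singular
  \<open>M\<close>.\<close>

lemma distr_gaussian_affine:
  fixes M :: "real^'n^'n"
  assumes P: "sym_pos_def P"
  shows "distr (gaussian m P) borel (\<lambda>x. M *v x + b) = gaussian (M *v m + b) (M ** P ** transpose M)"
proof -
  obtain S :: "real^'n^'n" where S: "S ** transpose S = P"
    using sym_pos_def_root[OF P] .
  have MS: "(M ** S) ** transpose (M ** S) = M ** P ** transpose M"
    by (simp add: matrix_transpose_mul matrix_mul_assoc flip: S)
  show ?thesis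
    unfolding gaussian_eq_distr[OF S] gaussian_eq_distr[OF MS]
    by (simp add: distr_distr comp_def matrix_vector_right_distrib matrix_vector_mul_assoc
        algebra_simps)
qed

section \<open>The evidence as an iterated integral\<close>

text \<open>Dominated convergence along sequences, with the constant bound as the integrable
  majorant.\<close>

lemma continuous_on_integral_bounded:
  fixes h :: "'p::{first_countable_topology, t2_space} \<Rightarrow> 'z \<Rightarrow> real"
  assumes "finite_measure N" and "\<And>p. h p \<in> borel_measurable N"
    and "\<And>z. continuous_on UNIV (\<lambda>p. h p z)" and "\<And>p z. \<bar>h p z\<bar> \<le> B"
  shows "continuous_on UNIV (\<lambda>p. \<integral>z. h p z \<partial>N)"
proof (rule continuous_on_sequentiallyI)
  interpret finite_measure N by fact
  fix u a assume u: "u \<longlonglongrightarrow> (a :: 'p)"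
  show "(\<lambda>n. \<integral>z. h (u n) z \<partial>N) \<longlonglongrightarrow> (\<integral>z. h a z \<partial>N)"
  proof (rule integral_dominated_convergence[where w = "\<lambda>_. B"])
    show "AE z in N. (\<lambda>n. h (u n) z) \<longlonglongrightarrow> h a z"
      using assms(3) u by (auto simp: continuous_on_def intro!: tendsto_compose[of "\<lambda>p. h p _"])
  qed (use assms in auto)
qed

lemma (in prob_space) integral_abs_bound_const:
  fixes f :: "'a \<Rightarrow> real"
  assumes "f \<in> borel_measurable M" "\<And>x. x \<in> space M \<Longrightarrow> \<bar>f x\<bar> \<le> B"
  shows "\<bar>\<integral>x. f x \<partial>M\<bar> \<le> B"
proof -
  have "integrable M f" using assms by (intro integrable_const_bound[of _ B]) auto
  hence "(\<integral>x. \<bar>f x\<bar> \<partial>M) \<le> B" using assms by (intro integral_le_const) auto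
  thus ?thesis using integral_abs_bound[of M f] by linarith
qed

text \<open>The unnormalised filter: \<open>path_integral \<pi>0 K g t f\<close> is the expectation of
  \<open>g\<^sub>1(x\<^sub>1) \<cdots> g\<^sub>t(x\<^sub>t) f(x\<^sub>t)\<close> under the law of the signal, written as an iterated integral.\<close>

primrec path_integral ::
  "'a measure \<Rightarrow> (nat \<Rightarrow> 'a \<Rightarrow> 'a measure) \<Rightarrow> (nat \<Rightarrow> 'a \<Rightarrow> real) \<Rightarrow> nat \<Rightarrow> ('a \<Rightarrow> real) \<Rightarrow> real"
where
  "path_integral \<pi>0 K g 0 f = (\<integral>x. f x \<partial>\<pi>0)"
| "path_integral \<pi>0 K g (Suc t) f =
     path_integral \<pi>0 K g t (\<lambda>x. \<integral>x'. g (Suc t) x' * f x' \<partial>K (Suc t) x)"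

text \<open>All kernels are images of one noise law \<open>N\<close> free of the parameter, so
  \<open>p\<close> enters only through integrands. The test function may depend on \<open>p\<close>
  as well, because integrating out one step produces such a function, again bounded and jointly
  continuous; this carries the induction.\<close>

lemma continuous_on_path_integral:
  fixes \<phi> :: "nat \<Rightarrow> 'p::metric_space \<Rightarrow> 'a::euclidean_space \<Rightarrow> 'z \<Rightarrow> 'a"
  assumes \<pi>0: "prob_space \<pi>0" "sets \<pi>0 = sets borel" and N: "prob_space N"
    and K: "\<And>p t x. t \<in> {1..T} \<Longrightarrow> K p t x = distr N borel (\<phi> t p x)"
    and \<phi>: "\<And>t p x. t \<in> {1..T} \<Longrightarrow> \<phi> t p x \<in> N \<rightarrow>\<^sub>M borel"
      "\<And>t z. t \<in> {1..T} \<Longrightarrow> continuous_on UNIV (\<lambda>(p, x). \<phi> t p x z)"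
    and g: "\<And>t. t \<in> {1..T} \<Longrightarrow> continuous_on UNIV (g t)"
      "\<And>t x. t \<in> {1..T} \<Longrightarrow> \<bar>g t x\<bar> \<le> c t"
    and f: "continuous_on UNIV (\<lambda>(p, x). f p x)" "\<And>p x. \<bar>f p x\<bar> \<le> B"
    and t: "t \<le> T"
  shows "continuous_on UNIV (\<lambda>p. path_integral \<pi>0 (K p) g t (f p))"
  using t f
proof (induction t arbitrary: f B)
  case 0
  interpret \<pi>0: prob_space \<pi>0 by fact
  have meas: "f p \<in> borel_measurable \<pi>0" for p
    unfolding measurable_cong_sets[OF \<pi>0(2) refl]
    by (intro borel_measurable_continuous_onI continuous_on_compose2[OF 0(2), of UNIV "\<lambda>x. (p, x)", simplified]
        continuous_intros)
  have cont: "continuous_on UNIV (\<lambda>p. f p x)" for x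
    by (intro continuous_on_compose2[OF 0(2), of UNIV "\<lambda>p. (p, x)", simplified]
        continuous_intros)
  show ?case
    unfolding path_integral.simps
    using meas cont 0(3) by (intro continuous_on_integral_bounded) (auto intro: \<pi>0.finite_measure_axioms)
next
  case (Suc t)
  interpret N: prob_space N by fact
  have st: "Suc t \<in> {1..T}" using Suc.prems by simp
  note [measurable] = \<phi>(1)[OF st] borel_measurable_continuous_onI[OF g(1)[OF st]]
  have [measurable]: "f p \<in> borel_measurable borel" for p
    by (intro borel_measurable_continuous_onI continuous_on_compose2[OF Suc.prems(2), of UNIV "\<lambda>x. (p, x)", simplified]
        continuous_intros)
  \<comment> \<open>The pair \<open>(p, x)\<close> is treated as a single parameter, so that
    integrating over the noise gives joint continuity.\<close>
  define h where "h = (\<lambda>(p, x) z. g (Suc t) (\<phi> (Suc t) p x z) * f p (\<phi> (Suc t) p x z))"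
  have h_eq: "(\<integral>x'. g (Suc t) x' * f p x' \<partial>K p (Suc t) x) = (\<integral>z. h (p, x) z \<partial>N)" for p x
    unfolding K[OF st] h_def by (subst integral_distr) simp_all
  have h_meas: "h px \<in> borel_measurable N" for px
    by (cases px) (simp add: h_def)
  have h_bound: "\<bar>h px z\<bar> \<le> c (Suc t) * B" for px z
    using g(2)[OF st] Suc.prems(3) order_trans[OF abs_ge_zero Suc.prems(3)]
    by (cases px) (auto simp: h_def abs_mult intro!: mult_mono order_trans[OF abs_ge_zero])
  have h_cont: "continuous_on UNIV (\<lambda>px. h px z)" for z
  proof -
    have 1: "continuous_on UNIV (\<lambda>px. \<phi> (Suc t) (fst px) (snd px) z)"
      using \<phi>(2)[OF st, of z] by (simp add: case_prod_beta)
    have 2: "continuous_on UNIV (\<lambda>px. f (fst px) (\<phi> (Suc t) (fst px) (snd px) z))"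
      using continuous_on_compose2[OF Suc.prems(2), of UNIV "\<lambda>px. (fst px, \<phi> (Suc t) (fst px) (snd px) z)"]
      by (simp add: 1 continuous_on_fst continuous_on_Pair continuous_on_id)
    show ?thesis
      unfolding h_def case_prod_beta
      by (intro continuous_on_mult 2 continuous_on_compose2[OF g(1)[OF st] 1]) simp
  qed
  show ?case
    unfolding path_integral.simps h_eq
  proof (rule Suc.IH)
    show "continuous_on UNIV (\<lambda>(p, x). \<integral>z. h (p, x) z \<partial>N)"
      using h_meas h_cont h_bound unfolding case_prod_beta prod.collapse
      by (intro continuous_on_integral_bounded N.finite_measure_axioms)
    show "\<bar>\<integral>z. h (p, x) z \<partial>N\<bar> \<le> c (Suc t) * B" for p x
      using h_meas h_bound by (rule N.integral_abs_bound_const)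
  qed (use Suc.prems in simp)
qed

text \<open>Boundedness of the likelihoods makes every integral finite, and positivity keeps the
  normalising constants of the filter away from zero. \<open>prob_algebra S\<close> bundles
  measurability with total mass one.\<close>

locale bounded_state_space_model =
  fixes S :: "'a measure" and \<pi>0 :: "'a measure"
    and K :: "nat \<Rightarrow> 'a \<Rightarrow> 'a measure" and g :: "nat \<Rightarrow> 'a \<Rightarrow> real" and c :: "nat \<Rightarrow> real" and T :: nat
  assumes prior: "\<pi>0 \<in> space (prob_algebra S)"
    and kernel[measurable]: "\<And>t. t \<in> {1..T} \<Longrightarrow> K t \<in> S \<rightarrow>\<^sub>M prob_algebra S"
    and likelihood_measurable[measurable]: "\<And>t. t \<in> {1..T} \<Longrightarrow> g t \<in> borel_measurable S"
    and likelihood_pos: "\<And>t x. t \<in> {1..T} \<Longrightarrow> 0 < g t x"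
    and likelihood_le: "\<And>t x. t \<in> {1..T} \<Longrightarrow> g t x \<le> c t"
begin

lemma likelihood_integrable:
  assumes "t \<in> {1..T}" "\<mu> \<in> space (prob_algebra S)" shows "integrable \<mu> (g t)"
proof -
  interpret prob_space \<mu> using assms by (simp add: space_prob_algebra)
  show ?thesis
    using assms likelihood_pos[OF assms(1)] likelihood_le[OF assms(1)]
    by (intro integrable_const_bound[of _ "c t"])
      (auto simp: space_prob_algebra less_imp_le cong: measurable_cong_sets)
qed

lemma likelihood_integral_pos:
  assumes t: "t \<in> {1..T}" and \<mu>: "\<mu> \<in> space (prob_algebra S)" shows "0 < (\<integral>x. g t x \<partial>\<mu>)"
proof -
  interpret prob_space \<mu> using assms by (simp add: space_prob_algebra)
  have "(\<integral>x. 0 \<partial>\<mu>) < (\<integral>x. g t x \<partial>\<mu>)"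
    using likelihood_pos[OF t] by (intro integral_less_AE_space likelihood_integrable t \<mu>) (auto simp: emeasure_space_1)
  thus ?thesis by simp
qed

lemma bind_kernel:
  assumes "t \<in> {1..T}" "\<mu> \<in> space (prob_algebra S)" shows "bind \<mu> (K t) \<in> space (prob_algebra S)"
  using prob_space_bind'[OF assms(2) kernel[OF assms(1)]] sets_bind'[OF assms(2) kernel[OF assms(1)]]
  by (simp add: space_prob_algebra)

lemma filter_law_prob: "t \<le> T \<Longrightarrow> filter_law \<pi>0 K g t \<in> space (prob_algebra S)"
proof (induction t)
  case (Suc t)
  hence t: "Suc t \<in> {1..T}" by simp
  define \<xi> where "\<xi> = bind (filter_law \<pi>0 K g t) (K (Suc t))"
  have \<xi>: "\<xi> \<in> space (prob_algebra S)"
    unfolding \<xi>_def using Suc by (intro bind_kernel) auto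
  hence [measurable_cong]: "sets \<xi> = sets S" by (simp add: space_prob_algebra)
  note pos = likelihood_integral_pos[OF t \<xi>]
  have [measurable]: "g (Suc t) \<in> borel_measurable \<xi>" using t by measurable
  have "prob_space (density \<xi> (\<lambda>x. ennreal (g (Suc t) x / (\<integral>x. g (Suc t) x \<partial>\<xi>))))"
  proof
    have "(\<integral>\<^sup>+x. ennreal (g (Suc t) x / (\<integral>x. g (Suc t) x \<partial>\<xi>)) \<partial>\<xi>)
        = ennreal (\<integral>x. g (Suc t) x / (\<integral>x. g (Suc t) x \<partial>\<xi>) \<partial>\<xi>)"
      using pos likelihood_pos[OF t]
      by (intro nn_integral_eq_integral integrable_divide likelihood_integrable t \<xi>) (auto simp: less_imp_le)
    thus "emeasure (density \<xi> (\<lambda>x. ennreal (g (Suc t) x / (\<integral>x. g (Suc t) x \<partial>\<xi>))))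
        (space (density \<xi> (\<lambda>x. ennreal (g (Suc t) x / (\<integral>x. g (Suc t) x \<partial>\<xi>))))) = 1"
      using pos by (simp add: emeasure_density cong: nn_integral_cong)
  qed
  thus ?case
    using \<xi> by (simp add: Let_def space_prob_algebra flip: \<xi>_def)
qed (simp add: prior)

lemma predictive_prob: "t \<in> {1..T} \<Longrightarrow> predictive \<pi>0 K g t \<in> space (prob_algebra S)"
  unfolding predictive_def by (intro bind_kernel filter_law_prob) auto

lemma integral_bind_kernel:
  fixes f :: "'a \<Rightarrow> real"
  assumes t: "t \<in> {1..T}" and \<mu>: "\<mu> \<in> space (prob_algebra S)"
    and f: "f \<in> borel_measurable S" "\<And>x. x \<in> space S \<Longrightarrow> \<bar>f x\<bar> \<le> B"
  shows "(\<integral>x. f x \<partial>bind \<mu> (K t)) = (\<integral>x. \<integral>y. f y \<partial>K t x \<partial>\<mu>)"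
proof (rule integral_bind[OF f(1), where B = B and B' = 1])
  have [measurable_cong]: "sets \<mu> = sets S" using \<mu> by (simp add: space_prob_algebra)
  show K: "K t \<in> \<mu> \<rightarrow>\<^sub>M subprob_algebra S"
    using measurable_prob_algebraD[OF kernel[OF t]] by measurable
  show "finite_measure \<mu>" using \<mu> by (simp add: space_prob_algebra prob_space.finite_measure)
  show "AE x in \<mu>. emeasure (K t x) (space (K t x)) \<le> ennreal 1"
    using subprob_space.subprob_emeasure_le_1[OF subprob_space_kernel[OF K]] by auto
qed (use f in auto)

lemma kernel_prob: "t \<in> {1..T} \<Longrightarrow> x \<in> space S \<Longrightarrow> K t x \<in> space (prob_algebra S)"
  by (rule measurable_space[OF kernel])

lemma integral_kernel_measurable:
  fixes f :: "'a \<Rightarrow> real"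
  assumes "t \<in> {1..T}" "f \<in> borel_measurable S"
  shows "(\<lambda>x. \<integral>y. f y \<partial>K t x) \<in> borel_measurable S"
  by (rule measurable_compose[OF measurable_prob_algebraD[OF kernel[OF assms(1)]]
        integral_measurable_subprob_algebra[OF assms(2)]])

lemma integral_kernel_bound:
  fixes f :: "'a \<Rightarrow> real"
  assumes t: "t \<in> {1..T}" and x: "x \<in> space S"
    and f: "f \<in> borel_measurable S" "\<And>x. x \<in> space S \<Longrightarrow> \<bar>f x\<bar> \<le> B"
  shows "\<bar>\<integral>y. f y \<partial>K t x\<bar> \<le> B"
proof (rule prob_space.integral_abs_bound_const)
  have K: "prob_space (K t x)" "sets (K t x) = sets S"
    using kernel_prob[OF t x] by (simp_all add: space_prob_algebra)
  thus "prob_space (K t x)" "f \<in> borel_measurable (K t x)"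
    using f(1) by (auto cong: measurable_cong_sets)
  show "\<bar>f y\<bar> \<le> B" if "y \<in> space (K t x)" for y
    using that f(2) sets_eq_imp_space_eq[OF K(2)] by simp
qed

text \<open>Each filter update divides by the very factor that the evidence gains at that time, so
  the normalising constants cancel. A general \<open>f\<close> is needed because the induction
  replaces \<open>f\<close> by the kernel average of \<open>g (Suc t) * f\<close>.\<close>

lemma evidence_filter_eq_path_integral:
  fixes f :: "'a \<Rightarrow> real"
  assumes "t \<le> T" "f \<in> borel_measurable S" "\<And>x. x \<in> space S \<Longrightarrow> \<bar>f x\<bar> \<le> B"
  shows "evidence \<pi>0 K g t * (\<integral>x. f x \<partial>filter_law \<pi>0 K g t) = path_integral \<pi>0 K g t f"
  using assms
proof (induction t arbitrary: f B)
  case 0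
  show ?case by (simp add: evidence_def)
next
  case (Suc t)
  have t: "Suc t \<in> {1..T}" using Suc.prems by simp
  define \<pi> \<xi> where "\<pi> = filter_law \<pi>0 K g t" and "\<xi> = bind \<pi> (K (Suc t))"
  have \<pi>: "\<pi> \<in> space (prob_algebra S)" unfolding \<pi>_def using Suc.prems by (intro filter_law_prob) auto
  hence \<xi>: "\<xi> \<in> space (prob_algebra S)" unfolding \<xi>_def by (intro bind_kernel t)
  hence [measurable_cong]: "sets \<xi> = sets S" by (simp add: space_prob_algebra)
  define z where "z = (\<integral>x. g (Suc t) x \<partial>\<xi>)"
  have z: "z > 0" unfolding z_def by (rule likelihood_integral_pos[OF t \<xi>])
  define h where "h x = g (Suc t) x * f x" for x
  note [measurable] = Suc.prems(2) likelihood_measurable[OF t] measurable_prob_algebraD[OF kernel[OF t]]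
  have h_meas[measurable]: "h \<in> borel_measurable S" unfolding h_def by measurable
  have h_bound: "\<bar>h x\<bar> \<le> c (Suc t) * B" if "x \<in> space S" for x
    using likelihood_le[OF t, of x] likelihood_pos[OF t, of x] Suc.prems(3)[OF that]
    by (auto simp: h_def abs_mult intro!: mult_mono)
  have evid: "evidence \<pi>0 K g (Suc t) = evidence \<pi>0 K g t * z"
    by (simp add: evidence_def predictive_def z_def \<xi>_def \<pi>_def mult.commute)
  have "z * (\<integral>x. f x \<partial>filter_law \<pi>0 K g (Suc t)) = z * (\<integral>x. g (Suc t) x / z * f x \<partial>\<xi>)"
    using z likelihood_pos[OF t]
    by (simp add: Let_def integral_real_density less_imp_le flip: \<pi>_def \<xi>_def z_def)
  also have "\<dots> = (\<integral>x. h x \<partial>\<xi>)"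
    using z by (simp add: h_def)
  also have "\<dots> = (\<integral>x. \<integral>y. h y \<partial>K (Suc t) x \<partial>\<pi>)"
    unfolding \<xi>_def by (rule integral_bind_kernel[OF t \<pi> h_meas h_bound])
  finally have "evidence \<pi>0 K g (Suc t) * (\<integral>x. f x \<partial>filter_law \<pi>0 K g (Suc t)) =
      evidence \<pi>0 K g t * (\<integral>x. \<integral>y. h y \<partial>K (Suc t) x \<partial>\<pi>)"
    by (simp add: evid)
  also have "\<dots> = path_integral \<pi>0 K g t (\<lambda>x. \<integral>y. h y \<partial>K (Suc t) x)"
    unfolding \<pi>_def
  proof (rule Suc.IH)
    show "(\<lambda>x. \<integral>y. h y \<partial>K (Suc t) x) \<in> borel_measurable S"
      by (rule integral_kernel_measurable[OF t h_meas])
    show "\<bar>\<integral>y. h y \<partial>K (Suc t) x\<bar> \<le> c (Suc t) * B" if "x \<in> space S" for x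
      using h_meas h_bound by (rule integral_kernel_bound[OF t that])
  qed (use Suc.prems in simp)
  finally show ?case by (simp add: h_def)
qed

text \<open>This form of the evidence contains no division and is the one to which the continuity
  result applies.\<close>

corollary evidence_eq_path_integral: "evidence \<pi>0 K g T = path_integral \<pi>0 K g T (\<lambda>_. 1)"
  using evidence_filter_eq_path_integral[of T "\<lambda>_. 1" 1] filter_law_prob[of T]
  by (simp add: space_prob_algebra prob_space.prob_space)

end

section \<open>Comparing the evidence of two models\<close>

lemma filter_law_cong:
  assumes "\<And>s. s \<in> {1..t} \<Longrightarrow> K s = K' s"
  shows "filter_law \<pi>0 K g t = filter_law \<pi>0 K' g t"
  using assms by (induction t) auto

lemma predictive_cong:
  assumes "\<And>s. s \<in> {1..t} \<Longrightarrow> K s = K' s" and "t \<ge> 1"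
  shows "predictive \<pi>0 K g t = predictive \<pi>0 K' g t"
proof -
  have "filter_law \<pi>0 K g (t - 1) = filter_law \<pi>0 K' g (t - 1)"
    using assms by (intro filter_law_cong) auto
  thus ?thesis using assms by (simp add: predictive_def)
qed

lemma evidence_cong:
  assumes "\<And>t. t \<in> {1..T} \<Longrightarrow> K t = K' t"
  shows "evidence \<pi>0 K g T = evidence \<pi>0 K' g T"
  using assms unfolding evidence_def
  by (intro prod.cong refl arg_cong[of _ _ "\<lambda>\<mu>. integral\<^sup>L \<mu> (g _)"] predictive_cong) auto

text \<open>The factors are compared one by one. Before \<open>s\<close> the models coincide; after
  \<open>s\<close> the likelihood is constant, so its integral is \<open>d t\<close> under any
  predictive law. At \<open>s\<close> both predictive laws start from the same filter, and
  integrating \<open>gain\<close> against it makes this factor strictly larger.\<close>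

lemma evidence_strict_mono:
  assumes M: "bounded_state_space_model S \<pi>0 K g c T" and M': "bounded_state_space_model S \<pi>0 K' g c T"
    and s: "s \<in> {1..T}" and before: "\<And>t. t \<in> {1..<s} \<Longrightarrow> K t = K' t"
    and after: "\<And>t x. t \<in> {s<..T} \<Longrightarrow> g t x = d t"
    and gain: "\<And>x. (\<integral>x'. g s x' \<partial>K s x) < (\<integral>x'. g s x' \<partial>K' s x)"
  shows "evidence \<pi>0 K g T < evidence \<pi>0 K' g T"
proof -
  interpret M: bounded_state_space_model S \<pi>0 K g c T by fact
  interpret M': bounded_state_space_model S \<pi>0 K' g c T by fact
  let ?a = "\<lambda>t. \<integral>x. g t x \<partial>predictive \<pi>0 K g t" and ?b = "\<lambda>t. \<integral>x. g t x \<partial>predictive \<pi>0 K' g t"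
  have "?a t = ?b t" if "t \<in> {1..T} - {s}" for t
  proof (cases "t < s")
    case True
    thus ?thesis using that predictive_cong[of t K K' \<pi>0 g] before by auto
  next
    case False
    hence "t \<in> {s<..T}" "t \<in> {1..T}" using that by auto
    thus ?thesis
      using M.predictive_prob[of t] M'.predictive_prob[of t]
      by (simp add: after space_prob_algebra prob_space.prob_space)
  qed
  hence rest: "prod ?a ({1..T} - {s}) = prod ?b ({1..T} - {s})" by (intro prod.cong) auto
  have "?a s < ?b s"
  proof -
    let ?\<pi> = "filter_law \<pi>0 K g (s - 1)"
    have eq: "filter_law \<pi>0 K' g (s - 1) = ?\<pi>"
      using before by (intro filter_law_cong) auto
    have \<pi>: "?\<pi> \<in> space (prob_algebra S)" using s by (intro M.filter_law_prob) auto
    interpret \<pi>: prob_space ?\<pi> using \<pi> by (simp add: space_prob_algebra)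
    have bounded: "\<bar>g s x\<bar> \<le> c s" for x
      using M.likelihood_pos[OF s, of x] M.likelihood_le[OF s, of x] by simp
    note g_meas = M.likelihood_measurable[OF s]
    have meas: "f \<in> borel_measurable ?\<pi>" if "f \<in> borel_measurable S" for f :: "_ \<Rightarrow> real"
      using that \<pi> by (simp add: space_prob_algebra cong: measurable_cong_sets)
    have space: "space ?\<pi> = space S"
      using \<pi> by (intro sets_eq_imp_space_eq) (simp add: space_prob_algebra)
    have "(\<integral>x. \<integral>x'. g s x' \<partial>K s x \<partial>?\<pi>) < (\<integral>x. \<integral>x'. g s x' \<partial>K' s x \<partial>?\<pi>)"
    proof (rule \<pi>.integral_less_AE_space)
      show "integrable ?\<pi> (\<lambda>x. \<integral>x'. g s x' \<partial>K s x)"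
        using M.integral_kernel_bound[OF s _ g_meas bounded]
        by (intro \<pi>.integrable_const_bound[of _ "c s"] meas M.integral_kernel_measurable s g_meas)
          (auto simp: space[unfolded One_nat_def] intro!: AE_I2)
      show "integrable ?\<pi> (\<lambda>x. \<integral>x'. g s x' \<partial>K' s x)"
        using M'.integral_kernel_bound[OF s _ g_meas bounded]
        by (intro \<pi>.integrable_const_bound[of _ "c s"] meas M'.integral_kernel_measurable s g_meas)
          (auto simp: space[unfolded One_nat_def] intro!: AE_I2)
    qed (use gain \<pi>.emeasure_space_1 in auto)
    thus ?thesis
      unfolding predictive_def eq
        M.integral_bind_kernel[OF s \<pi> g_meas bounded] M'.integral_bind_kernel[OF s \<pi> g_meas bounded] .
  qed
  moreover have "prod ?b ({1..T} - {s}) > 0"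
    by (intro prod_pos) (blast intro: M'.likelihood_integral_pos M'.predictive_prob)
  ultimately show ?thesis
    unfolding evidence_def prod.remove[OF finite_atLeastAtMost s] rest
    by (rule mult_strict_right_mono)
qed

section \<open>Nudging a linear-Gaussian model\<close>

lemma prob_space_gaussian: "prob_space (gaussian m P)"
  unfolding gaussian_def by (intro prob_space.prob_space_distr prob_space_std_gaussian) measurable

lemma sets_gaussian[simp, measurable_cong]: "sets (gaussian m P) = sets borel"
  by (simp add: gaussian_def)

lemma gaussian_in_prob_algebra: "gaussian m P \<in> space (prob_algebra borel)"
  by (simp add: space_prob_algebra prob_space_gaussian)

text \<open>Only the mean varies, and it enters through a jointly measurable map applied to a fixed
  noise law.\<close>

lemma gaussian_kernel_measurable:
  fixes f :: "real^'n \<Rightarrow> real^'n"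
  assumes [measurable]: "f \<in> borel_measurable borel"
  shows "(\<lambda>x. gaussian (f x) P) \<in> borel \<rightarrow>\<^sub>M prob_algebra borel"
proof (rule measurable_prob_algebraI)
  show "(\<lambda>x. gaussian (f x) P) \<in> borel \<rightarrow>\<^sub>M subprob_algebra borel"
    unfolding gaussian_def
  proof (rule measurable_distr2)
    show "(\<lambda>(x, z). f x + (SOME S. S ** transpose S = P) *v z) \<in> borel \<Otimes>\<^sub>M borel \<rightarrow>\<^sub>M borel"
      by measurable
    show "(\<lambda>_. std_gaussian) \<in> borel \<rightarrow>\<^sub>M subprob_algebra borel"
      using prob_space_std_gaussian
      by (intro measurable_const) (auto simp: space_subprob_algebra intro: prob_space_imp_subprob_space)
  qed
qed (rule prob_space_gaussian)

section \<open>Null sets of the standard Gaussian law\<close>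

lemma AE_lborel_hyperplane:
  fixes a :: "'a::euclidean_space"
  assumes "a \<noteq> 0" shows "AE x in lborel. a \<bullet> x \<noteq> b"
proof -
  have "{x. a \<bullet> x = b} \<in> null_sets lebesgue"
    using negligible_hyperplane assms by (metis negligible_iff_null_sets)
  from AE_not_in[OF this] show ?thesis by (simp add: AE_completion_iff)
qed

text \<open>A nonzero row of \<open>B\<close> confines the solutions of \<open>B *v z = b\<close> to
  a hyperplane.\<close>

lemma AE_std_gaussian_affine:
  fixes B :: "real^'n^'m"
  assumes "B \<noteq> 0" shows "AE z in std_gaussian. B *v z \<noteq> b"
proof -
  obtain i where "row i B \<noteq> 0"
    using assms by (auto simp: vec_eq_iff row_def)
  hence "AE z in lborel. row i B \<bullet> z \<noteq> b $ i" by (rule AE_lborel_hyperplane)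
  hence "AE z in lborel. B *v z \<noteq> b"
    by eventually_elim (metis matrix_vector_mult_component_row)
  thus ?thesis
    unfolding std_gaussian_def by (subst AE_density) (measurable, auto elim: eventually_mono)
qed

section \<open>The Gaussian likelihood and its score\<close>

lemma continuous_on_matrix_vector_mult[continuous_intros]:
  "continuous_on X f \<Longrightarrow> continuous_on X (\<lambda>x. (A :: real^'n^'m) *v f x)"
  by (rule bounded_linear.continuous_on[OF matrix_vector_mul_bounded_linear])

text \<open>The gradient of the log-likelihood, by \<open>gradient_log_likelihood\<close>; the
  constant of proportionality has dropped out.\<close>

definition score :: "real^'n^'m \<Rightarrow> real^'m^'m \<Rightarrow> real^'m \<Rightarrow> real^'n \<Rightarrow> real^'n" where
  "score C R y x = (transpose C ** matrix_inv R) *v (y - C *v x)"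

lemma nudge_matrix_shift_eq_score:
  "nudge_matrix C R \<gamma> *v x + nudge_shift C R y \<gamma> = x + \<gamma> *\<^sub>R score C R y x"
  by (simp add: nudge_matrix_def nudge_shift_def score_def matrix_vector_mult_diff_rdistrib
      matrix_vector_mult_diff_distrib matrix_vector_mul_assoc scaleR_matrix_vector_assoc[symmetric]
      scaleR_diff_right del: transpose_matrix_vector)

lemma continuous_on_score[continuous_intros]:
  "continuous_on X f \<Longrightarrow> continuous_on X (\<lambda>x. score C R y (f x))"
  unfolding score_def by (intro continuous_intros)

locale gaussian_likelihood =
  fixes C :: "real^'n^'m" and R :: "real^'m^'m" and y :: "real^'m" and g :: "real^'n \<Rightarrow> real" and c :: real
  assumes R: "sym_pos_def R" and c: "c > 0"
    and g: "\<And>x. g x = c * exp (- (1/2) * ((y - C *v x) \<bullet> (matrix_inv R *v (y - C *v x))))"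
begin

abbreviation "W \<equiv> matrix_inv R"

lemma W: "sym_pos_def W"
  by (rule sym_pos_def_matrix_inv[OF R])

lemma inner_W_commute: "u \<bullet> (W *v v) = v \<bullet> (W *v u)"
  by (rule sym_pos_def_symmetric[OF W])

lemma W_nonneg: "0 \<le> u \<bullet> (W *v u)"
  using W by (cases "u = 0") (auto simp: sym_pos_def_def less_imp_le)

lemma inner_score: "h \<bullet> score C R y x = (C *v h) \<bullet> (W *v (y - C *v x))"
  by (simp add: score_def matrix_inner_adjoint[of "C *v h", symmetric] flip: matrix_vector_mul_assoc)
    (metis dot_lmul_matrix inner_commute)

lemma likelihood_pos: "0 < g x" and likelihood_le: "g x \<le> c"
  using c W_nonneg[of "y - C *v x"] by (simp_all add: g mult_le_cancel_left1)

lemma continuous_on_likelihood: "continuous_on X g"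
  unfolding g by (intro continuous_intros)

text \<open>The quadratic form contributes two derivative terms, equal by symmetry of
  \<open>W\<close>, which cancels the factor 1/2. Since \<open>gradient\<close> is a definite
  description, uniqueness of the representing vector is proved too.\<close>

lemma gradient_log_likelihood: "gradient (\<lambda>x. ln (g x)) x = score C R y x"
proof -
  have eq: "(\<lambda>x. ln (g x)) = (\<lambda>x. ln c - (1/2) * ((y - C *v x) \<bullet> (W *v (y - C *v x))))"
    using c by (simp add: g ln_mult fun_eq_iff)
  have r: "((\<lambda>x. y - C *v x) has_derivative (\<lambda>h. - (C *v h))) (at x)"
    by (rule has_derivative_eq_rhs[OF has_derivative_diff[OF has_derivative_const
            bounded_linear_imp_has_derivative[OF matrix_vector_mul_bounded_linear]]]) simp
  have Wr: "((\<lambda>x. W *v (y - C *v x)) has_derivative (\<lambda>h. W *v - (C *v h))) (at x)"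
    by (rule bounded_linear.has_derivative[OF matrix_vector_mul_bounded_linear r])
  have deriv: "GDERIV (\<lambda>x. ln (g x)) x :> score C R y x"
    unfolding gderiv_def eq
  proof (rule has_derivative_eq_rhs[OF has_derivative_diff[OF has_derivative_const
          has_derivative_mult_right[OF has_derivative_inner[OF r Wr]]]], rule ext)
    fix h
    show "0 - 1/2 * ((y - C *v x) \<bullet> (W *v - (C *v h)) + - (C *v h) \<bullet> (W *v (y - C *v x))) =
        h \<bullet> score C R y x"
      unfolding inner_score inner_W_commute[of "y - C *v x" "- (C *v h)"] by simp
  qed
  show ?thesis
    unfolding gradient_def
  proof (rule the_equality)
    show "GDERIV (\<lambda>x. ln (g x)) x :> score C R y x" by (rule deriv)
    fix D assume "GDERIV (\<lambda>x. ln (g x)) x :> D"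
    hence "(\<lambda>h. h \<bullet> D) = (\<lambda>h. h \<bullet> score C R y x)"
      using deriv unfolding gderiv_def by (rule has_derivative_unique)
    thus "D = score C R y x" by (metis vector_eq_ldot)
  qed
qed

text \<open>Along \<open>v = score x\<close>, the exponent changes by \<open>\<gamma> |v|\<^sup>2 - \<gamma>\<^sup>2/2 \<cdot> (C v)\<^sup>T W (C v)\<close>, which is
  positive for small \<open>\<gamma>\<close> uniformly in \<open>x\<close>.\<close>

lemma score_step_increases:
  obtains \<gamma> where "\<gamma> > 0"
    "\<And>x. score C R y x \<noteq> 0 \<Longrightarrow> g x < g (x + \<gamma> *\<^sub>R score C R y x)"
proof -
  define q where "q u = u \<bullet> (W *v u)" for u
  obtain L where L: "L > 0" "\<And>v. norm ((transpose C ** W ** C) *v v) \<le> norm v * L"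
    using bounded_linear.pos_bounded[OF matrix_vector_mul_bounded_linear[of "transpose C ** W ** C"]]
    by blast
  have bound: "q (C *v v) \<le> L * (norm v)\<^sup>2" for v
  proof -
    have "q (C *v v) = v \<bullet> ((transpose C ** W ** C) *v v)"
      by (simp add: q_def inner_commute[of v] flip: matrix_vector_mul_assoc)
        (metis dot_lmul_matrix inner_commute)
    also have "\<dots> \<le> norm v * (norm v * L)"
      by (rule order_trans[OF norm_cauchy_schwarz mult_left_mono[OF L(2)]]) simp
    finally show ?thesis by (simp add: power2_eq_square mult_ac)
  qed
  have q_diff: "q (r - u) = q r - 2 * (u \<bullet> (W *v r)) + q u" for r u
    using inner_W_commute[of r u] by (simp add: q_def matrix_vector_mult_diff_distrib inner_diff)
  \<comment> \<open>With \<open>L\<close> bounding the operator norm of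
    \<open>transpose C ** W ** C\<close>, this step size lets the second-order term consume at most
    half of the first-order gain.\<close>
  let ?\<gamma> = "1 / L"
  have step: "q (y - C *v (x + ?\<gamma> *\<^sub>R v)) \<le> q (y - C *v x) - ?\<gamma> * (norm v)\<^sup>2"
    if v: "v = score C R y x" for x v
  proof -
    let ?r = "y - C *v x"
    have "q (y - C *v (x + ?\<gamma> *\<^sub>R v)) = q (?r - ?\<gamma> *\<^sub>R (C *v v))"
      by (simp add: matrix_vector_right_distrib matrix_vector_mult_scaleR diff_diff_eq)
    also have "\<dots> = q ?r - 2 * ?\<gamma> * ((C *v v) \<bullet> (W *v ?r)) + ?\<gamma>\<^sup>2 * q (C *v v)"
      by (subst q_diff) (simp add: q_def matrix_vector_mult_scaleR power2_eq_square)
    also have "(C *v v) \<bullet> (W *v ?r) = (norm v)\<^sup>2"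
      by (simp add: v power2_norm_eq_inner flip: inner_score)
    also have "?\<gamma>\<^sup>2 * q (C *v v) \<le> ?\<gamma>\<^sup>2 * (L * (norm v)\<^sup>2)"
      by (intro mult_left_mono bound) simp
    also have "?\<gamma>\<^sup>2 * (L * (norm v)\<^sup>2) = ?\<gamma> * (norm v)\<^sup>2"
      using L(1) by (simp add: power2_eq_square)
    finally show ?thesis by simp
  qed
  show thesis
  proof (rule that)
    show "?\<gamma> > 0" using L by simp
    show "g x < g (x + ?\<gamma> *\<^sub>R score C R y x)" if "score C R y x \<noteq> 0" for x
    proof -
      have "0 < ?\<gamma> * (norm (score C R y x))\<^sup>2" using L that by simp
      thus ?thesis using step[OF refl, of x] c by (simp add: g q_def)
    qed
  qed
qed

text \<open>The score is affine in \<open>z\<close> with linear part \<open>- (?G ** U)\<close>, so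
  its zeros form a null set once that matrix is nonzero. It is: for \<open>C *v v \<noteq> 0\<close>
  and \<open>U *v u = v\<close>, the number \<open>v \<bullet> (?G *v v)\<close> is the form of
  \<open>W\<close> at \<open>C *v v\<close>, which is positive.\<close>

lemma AE_score_nonzero:
  fixes U :: "real^'n^'n"
  assumes "C \<noteq> 0" "invertible U"
  shows "AE z in std_gaussian. score C R y (m + U *v z) \<noteq> 0"
proof -
  let ?G = "transpose C ** W ** C"
  obtain v where v: "C *v v \<noteq> 0"
    using assms(1) by (metis matrix_eq matrix_vector_mult_0)
  obtain u where u: "U *v u = v"
    using assms(2) by (metis invertible_def matrix_vector_mul_assoc matrix_vector_mul_lid)
  have "0 < (C *v v) \<bullet> (W *v (C *v v))" using W v by (simp add: sym_pos_def_def)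
  also have "\<dots> = v \<bullet> (?G *v v)"
    by (simp add: inner_commute[of v] flip: matrix_vector_mul_assoc)
      (metis dot_lmul_matrix inner_commute)
  finally have "(?G ** U) *v u \<noteq> 0"
    by (auto simp: u simp flip: matrix_vector_mul_assoc simp del: transpose_matrix_vector)
  hence "?G ** U \<noteq> 0" by auto
  hence "AE z in std_gaussian. (?G ** U) *v z \<noteq> score C R y m" by (rule AE_std_gaussian_affine)
  moreover have "score C R y (m + U *v z) = score C R y m - (?G ** U) *v z" for z
    by (simp add: score_def matrix_vector_right_distrib matrix_vector_mult_diff_distrib
        matrix_vector_mul_assoc matrix_mul_assoc del: transpose_matrix_vector)
  ultimately show ?thesis by (simp add: eq_commute[of "score C R y m"])
qed

end

text \<open>Either case gives the identity matrix and a zero shift. The first handles uninformative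
  observations, the second switches nudging off at a chosen time.\<close>

lemma nudged_kernel_eq_lin_gauss_kernel:
  assumes "C t = 0 \<or> \<gamma> t = 0"
  shows "nudged_kernel A Q C R y \<gamma> t = lin_gauss_kernel A Q t"
proof -
  have "nudge_matrix (C t) (R t) (\<gamma> t) = mat 1" "nudge_shift (C t) (R t) (y t) (\<gamma> t) = 0"
    using assms by (auto simp: nudge_matrix_def nudge_shift_def transpose_def matrix_matrix_mult_def
        matrix_vector_mult_def vec_eq_iff)
  thus ?thesis by (simp add: nudged_kernel_def lin_gauss_kernel_def fun_eq_iff)
qed

lemma lin_gauss_kernel_measurable: "lin_gauss_kernel A Q t \<in> borel \<rightarrow>\<^sub>M prob_algebra borel"
  unfolding lin_gauss_kernel_def by (rule gaussian_kernel_measurable) measurable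

lemma nudged_kernel_measurable: "nudged_kernel A Q C R y \<gamma> t \<in> borel \<rightarrow>\<^sub>M prob_algebra borel"
  unfolding nudged_kernel_def Let_def by (rule gaussian_kernel_measurable) measurable

text \<open>A gradient step is an affine map, so the nudged kernel is the image of the original one
  and can be driven by the same noise.\<close>

lemma nudged_kernel_eq_distr:
  assumes "sym_pos_def (Q t)"
  shows "nudged_kernel A Q C R y \<gamma> t x =
    distr (lin_gauss_kernel A Q t x) borel (\<lambda>w. w + \<gamma> t *\<^sub>R score (C t) (R t) (y t) w)"
  by (simp add: nudged_kernel_def lin_gauss_kernel_def Let_def distr_gaussian_affine[OF assms, symmetric]
      nudge_matrix_shift_eq_score)

theorem mainTheorem4:
  fixes T :: nat
    and m0 :: "real^'n" and P0 :: "real^'n^'n"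
    and A Q :: "nat \<Rightarrow> real^'n^'n"
    and C :: "nat \<Rightarrow> real^'n^'m" and R :: "nat \<Rightarrow> real^'m^'m"
    and y :: "nat \<Rightarrow> real^'m"
    and g :: "nat \<Rightarrow> real^'n \<Rightarrow> real"
  assumes "sym_pos_semidef P0"
    and "\<forall>t\<in>{1..T}. sym_pos_def (Q t)"
    and "\<forall>t\<in>{1..T}. sym_pos_def (R t)"
    and "\<forall>t\<in>{1..T}. \<exists>c>0. \<forall>x. g t x =
           c * exp (- (1/2) * ((y t - C t *v x) \<bullet> (matrix_inv (R t) *v (y t - C t *v x))))"
  shows "(\<forall>t\<in>{1..T}. \<forall>x \<gamma>.
            nudge g t x \<gamma> = nudge_matrix (C t) (R t) \<gamma> *v x + nudge_shift (C t) (R t) (y t) \<gamma>) \<and>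
         (\<forall>\<gamma>. \<forall>t\<in>{1..T}. \<forall>x. nudged_kernel A Q C R y \<gamma> t x =
            distr (lin_gauss_kernel A Q t x) borel (\<lambda>x'. nudge g t x' (\<gamma> t))) \<and>
         (\<exists>\<gamma> :: nat \<Rightarrow> real. (\<forall>t\<in>{1..T}. \<gamma> t > 0) \<and>
            evidence (gaussian m0 P0) (nudged_kernel A Q C R y \<gamma>) g T
              \<ge> evidence (gaussian m0 P0) (lin_gauss_kernel A Q) g T)"
proof -
  obtain c where c: "\<And>t. t \<in> {1..T} \<Longrightarrow> c t > 0 \<and> (\<forall>x. g t x =
      c t * exp (- (1/2) * ((y t - C t *v x) \<bullet> (matrix_inv (R t) *v (y t - C t *v x)))))"
    using bchoice[OF assms(4)] by blast
  have lik: "gaussian_likelihood (C t) (R t) (y t) (g t) (c t)" if "t \<in> {1..T}" for t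
    using c[OF that] assms(3) that by unfold_locales auto
  have nudge: "nudge g t x \<gamma> = x + \<gamma> *\<^sub>R score (C t) (R t) (y t) x" if "t \<in> {1..T}" for t x \<gamma>
    by (simp add: nudge_def gaussian_likelihood.gradient_log_likelihood[OF lik[OF that]])
  let ?\<pi>0 = "gaussian m0 P0" and ?K = "lin_gauss_kernel A Q" and ?K' = "nudged_kernel A Q C R y"
  have model: "bounded_state_space_model borel ?\<pi>0 ?K g c T"
    and model': "bounded_state_space_model borel ?\<pi>0 (?K' \<gamma>) g c T" for \<gamma>
    using lik
    by (unfold_locales; auto intro!: gaussian_in_prob_algebra lin_gauss_kernel_measurable nudged_kernel_measurable
        borel_measurable_continuous_onI gaussian_likelihood.continuous_on_likelihood
        intro: gaussian_likelihood.likelihood_pos gaussian_likelihood.likelihood_le)+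
  have "\<exists>\<gamma> :: nat \<Rightarrow> real. (\<forall>t\<in>{1..T}. \<gamma> t > 0) \<and> evidence ?\<pi>0 (?K' \<gamma>) g T \<ge> evidence ?\<pi>0 ?K g T"
  proof (cases "\<exists>t\<in>{1..T}. C t \<noteq> 0")
    case False
    hence "evidence ?\<pi>0 (?K' (\<lambda>_. 1)) g T = evidence ?\<pi>0 ?K g T"
      by (intro evidence_cong nudged_kernel_eq_lin_gauss_kernel) auto
    thus ?thesis by (intro exI[of _ "\<lambda>_. 1"]) simp
  next
    case True
    define s where "s = Max {t\<in>{1..T}. C t \<noteq> 0}"
    have "s \<in> {t\<in>{1..T}. C t \<noteq> 0}" unfolding s_def using True by (intro Max_in) auto
    hence s: "s \<in> {1..T}" "C s \<noteq> 0" by auto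
    have after: "C t = 0" if "t \<in> {s<..T}" for t
    proof (rule ccontr)
      assume "C t \<noteq> 0"
      hence "t \<le> s" unfolding s_def using that s(1) by (intro Max_ge) auto
      thus False using that by simp
    qed
    interpret lik: gaussian_likelihood "C s" "R s" "y s" "g s" "c s" by (rule lik[OF s(1)])
    obtain \<gamma>s where \<gamma>s: "\<gamma>s > 0"
      "\<And>x. score (C s) (R s) (y s) x \<noteq> 0 \<Longrightarrow> g s x < g s (x + \<gamma>s *\<^sub>R score (C s) (R s) (y s) x)"
      using lik.score_step_increases by blast
    \<comment> \<open>The parameter 0 stands for nudging at time \<open>s\<close> alone; positive
      \<epsilon> gives an admissible sequence.\<close>
    define \<gamma> where "\<gamma> \<epsilon> t = (if t = s then \<gamma>s else \<epsilon>)" for \<epsilon> :: real and t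
    \<comment> \<open>The very root chosen inside \<open>gaussian\<close>, so that
      \<open>K_noise\<close> holds by unfolding.\<close>
    define U :: "nat \<Rightarrow> real^'n^'n" where "U t = (SOME S. S ** transpose S = Q t)" for t
    define \<alpha> where "\<alpha> t \<epsilon> w = w + \<gamma> \<epsilon> t *\<^sub>R score (C t) (R t) (y t) w" for t \<epsilon> w
    have \<alpha>_cont: "continuous_on X (\<lambda>p. \<alpha> t (f p) (h p))"
      if "continuous_on X f" "continuous_on X h" for X :: "'b::topological_space set" and t f h
      unfolding \<alpha>_def \<gamma>_def using that by (cases "t = s") (auto intro!: continuous_intros)
    have \<alpha>_meas[measurable]: "\<alpha> t \<epsilon> \<in> borel_measurable borel" for t \<epsilon>
      by (intro borel_measurable_continuous_onI \<alpha>_cont continuous_intros)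
    have K_noise: "?K t x = distr std_gaussian borel (\<lambda>z. A t *v x + U t *v z)" for t x
      by (simp add: lin_gauss_kernel_def gaussian_def U_def)
    \<comment> \<open>With the noise shared by all \<epsilon>, the parameter occurs only in the map,
      as the continuity argument requires.\<close>
    have K'_noise: "?K' (\<gamma> \<epsilon>) t x = distr std_gaussian borel (\<lambda>z. \<alpha> t \<epsilon> (A t *v x + U t *v z))"
      if "t \<in> {1..T}" for \<epsilon> t x
      using assms(2) that
      by (simp add: nudged_kernel_eq_distr K_noise distr_distr comp_def flip: \<alpha>_def)
    have cont: "continuous_on UNIV (\<lambda>\<epsilon>. evidence ?\<pi>0 (?K' (\<gamma> \<epsilon>)) g T)"
      unfolding bounded_state_space_model.evidence_eq_path_integral[OF model']
    proof (rule continuous_on_path_integral[where N = std_gaussian and B = 1 and c = c])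
      show "?K' (\<gamma> \<epsilon>) t x = distr std_gaussian borel (\<lambda>z. \<alpha> t \<epsilon> (A t *v x + U t *v z))"
        if "t \<in> {1..T}" for \<epsilon> t x by (rule K'_noise[OF that])
      show "continuous_on UNIV (\<lambda>(\<epsilon>, x). \<alpha> t \<epsilon> (A t *v x + U t *v z))" for t z
        unfolding case_prod_beta by (intro \<alpha>_cont continuous_intros)
      show "continuous_on UNIV (g t)" "\<bar>g t x\<bar> \<le> c t" if "t \<in> {1..T}" for t x
        using gaussian_likelihood.continuous_on_likelihood[OF lik[OF that]]
          gaussian_likelihood.likelihood_pos[OF lik[OF that], of x]
          gaussian_likelihood.likelihood_le[OF lik[OF that], of x] by auto
    qed (auto intro: prob_space_gaussian prob_space_std_gaussian)
    \<comment> \<open>Positive definiteness of \<open>Q s\<close> enters here: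
      \<open>transpose (U s)\<close> times the inverse of \<open>Q s\<close> is a right inverse of
      \<open>U s\<close>.\<close>
    have "invertible (U s)"
    proof -
      have "sym_pos_def (Q s)" using assms(2) s by blast
      moreover from this have "U s ** transpose (U s) = Q s"
        unfolding U_def by (metis (mono_tags, lifting) someI sym_pos_def_root)
      ultimately obtain Q' where "U s ** (transpose (U s) ** Q') = mat 1"
        using sym_pos_def_invertible unfolding invertible_def by (metis matrix_mul_assoc)
      thus ?thesis by (auto simp: invertible_right_inverse)
    qed
    note AE_score = lik.AE_score_nonzero[OF s(2) this]
    have "evidence ?\<pi>0 ?K g T < evidence ?\<pi>0 (?K' (\<gamma> 0)) g T"
    proof (rule evidence_strict_mono[OF model model' s(1)])
      show "?K t = ?K' (\<gamma> 0) t" if "t \<in> {1..<s}" for t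
        using that by (intro nudged_kernel_eq_lin_gauss_kernel[symmetric]) (auto simp: \<gamma>_def)
      \<comment> \<open>Since \<open>C t = 0\<close> after time \<open>s\<close>, the likelihood
        does not depend on the state; its value at 0 serves as the constant.\<close>
      show "g t x = g t 0" if "t \<in> {s<..T}" for t x
        using c[of t] that s(1) after[OF that] by auto
      fix x
      interpret std: prob_space "std_gaussian :: (real^'n) measure" by (rule prob_space_std_gaussian)
      let ?w = "\<lambda>z. A s *v x + U s *v z"
      have g_meas[measurable]: "g s \<in> borel_measurable borel"
        by (intro borel_measurable_continuous_onI lik.continuous_on_likelihood)
      have integrable: "integrable std_gaussian (\<lambda>z. g s (f z))"
        if [measurable]: "f \<in> borel_measurable borel" for f :: "real^'n \<Rightarrow> real^'n"
        using lik.likelihood_pos lik.likelihood_le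
        by (intro std.integrable_const_bound[of _ "c s"]) (auto simp: less_imp_le)
      \<comment> \<open>Both integrals use the same noise \<open>z\<close>, so the gain of a
        gradient step applies pointwise wherever the score is nonzero.\<close>
      have "(\<integral>z. g s (?w z) \<partial>std_gaussian) < (\<integral>z. g s (\<alpha> s 0 (?w z)) \<partial>std_gaussian)"
      proof (rule std.integral_less_AE_space)
        show "AE z in std_gaussian. g s (?w z) < g s (\<alpha> s 0 (?w z))"
          using AE_score[of "A s *v x"] by eventually_elim (simp add: \<alpha>_def \<gamma>_def \<gamma>s(2))
      qed (auto intro!: integrable simp: std.emeasure_space_1[simplified])
      thus "(\<integral>x'. g s x' \<partial>?K s x) < (\<integral>x'. g s x' \<partial>?K' (\<gamma> 0) s x)"
        unfolding K_noise K'_noise[OF s(1)] by (simp add: integral_distr)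
    qed
    hence "\<forall>\<^sub>F \<epsilon> in at_right 0. evidence ?\<pi>0 ?K g T < evidence ?\<pi>0 (?K' (\<gamma> \<epsilon>)) g T"
      using cont by (intro order_tendstoD(1)) (auto simp: continuous_on_def intro: tendsto_within_subset)
    hence "\<forall>\<^sub>F \<epsilon> in at_right 0. \<epsilon> > 0 \<and> evidence ?\<pi>0 ?K g T < evidence ?\<pi>0 (?K' (\<gamma> \<epsilon>)) g T"
      by (intro eventually_conj eventually_at_right_less)
    then obtain \<epsilon> where "\<epsilon> > 0" "evidence ?\<pi>0 ?K g T < evidence ?\<pi>0 (?K' (\<gamma> \<epsilon>)) g T"
      by (auto dest!: eventually_happens simp: trivial_limit_at_right_real)
    thus ?thesis
      using \<gamma>s(1) by (intro exI[of _ "\<gamma> \<epsilon>"]) (auto simp: \<gamma>_def less_imp_le)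
  qed
  moreover have "?K' \<gamma> t x = distr (?K t x) borel (\<lambda>x'. nudge g t x' (\<gamma> t))" if "t \<in> {1..T}" for \<gamma> t x
    using assms(2) that by (simp add: nudged_kernel_eq_distr nudge)
  ultimately show ?thesis
    by (simp add: nudge nudge_matrix_shift_eq_score)
qed

end
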